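(* For $(\underline{s}_1,\underline{s}_2,\overline{s}_1,\overline{s}_2)\in\mathbb{D}$ and $i\in\{-1,0,1\}$ we have $$\mathbf{t}^{(i,1)}(\underline{s}_1,\underline{s}_2,\overline{s}_1,\overline{s}_2)=\mathbf{t}^{(i,1)}(\underline{s}_1,\overline{s}_2,\overline{s}_1,\overline{s}_2).$$
   Context: $\mathbb{R}_+=[0,\infty)$. $\mathbb{D}=\{(\underline{s}_1,\underline{s}_2,\overline{s}_1,\overline{s}_2)\in\mathbb{R}_+^2\times\mathbb{R}_+^2:\ 0<\underline{s}_1\le\overline{s}_1,\ 0<\underline{s}_2\le\overline{s}_2\}$. For $(x,y_1,y_2)\in\mathbb{R}_+\times\mathbb{R}_+^2$ and prices in $\mathbb{D}$, $\mathbb{A}(x,y_1,y_2,\underline{s}_1,\underline{s}_2,\overline{s}_1,\overline{s}_2)$ is the set of all $(l_1,l_2,m_1,m_2)\in\mathbb{R}_+^2\times\mathbb{R}_+^2$ with $0\le x+\underline{s}_1m_1+\underline{s}_2m_2-\overline{s}_1l_1-\overline{s}_2l_2$, $0\le y_i-m_i+l_i$ and $m_i\le y_i$ for $i=1,2$. $g:\mathbb{R}_+\times\mathbb{R}_+^2\to\mathbb{R}\cup\{-\infty\}$ is a fixed strictly concave function, strictly increasing with respect to each variable; $$\varphi(x,y_1,y_2,\underline{s}_1,\underline{s}_2,\overline{s}_1,\overline{s}_2,l_1,l_2,m_1,m_2)=g\big(x+\underline{s}_1m_1+\underline{s}_2m_2-\overline{s}_1l_1-\overline{s}_2l_2,\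 y_1-m_1+l_1,\ y_2-m_2+l_2\big),$$ and $\Phi(x,y_1,y_2,\underline{s}_1,\underline{s}_2,\overline{s}_1,\overline{s}_2)$ is the supremum of $\varphi$ over $(l_1,l_2,m_1,m_2)\in\mathbb{A}(x,y_1,y_2,\underline{s}_1,\underline{s}_2,\overline{s}_1,\overline{s}_2)$. For $(i_1,i_2)\in\{-1,0,1\}^2$, $\mathbb{A}^{(i_1,i_2)}(x,y_1,y_2,\underline{s}_1,\underline{s}_2,\overline{s}_1,\overline{s}_2)$ is the set of $(l_1,l_2,m_1,m_2)\in\mathbb{A}(x,y_1,y_2,\underline{s}_1,\underline{s}_2,\overline{s}_1,\overline{s}_2)$ with $i_1=\operatorname{sgn}(l_1-m_1)$, $i_2=\operatorname{sgn}(l_2-m_2)$, $l_1m_1+l_2m_2=0$ (with $\operatorname{sgn}\in\{-1,0,1\}$). The trading set $\mathbf{t}^{(i_1,i_2)}(\underline{s}_1,\underline{s}_2,\overline{s}_1,\overline{s}_2)$ is the set of $(x,y_1,y_2)\in\mathbb{R}_+\times\mathbb{R}_+^2$ for which there is $(l_1,l_2,m_1,m_2)\in\mathbb{A}^{(i_1,i_2)}(x,y_1,y_2,\underline{s}_1,\underline{s}_2,\overline{s}_1,\overline{s}_2)$ with $\Phi(x,y_1,y_2,\underline{s}_1,\underline{s}_2,\overline{s}_1,\overline{s}_2)=\varphi(x,y_1,y_2,\underline{s}_1,\underline{s}_2,\overline{s}_1,\overline{s}_2,l_1,l_2,m_1,m_2)$. Arguments are always ordered (bid 1, bid 2, ask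 1, ask 2). *)

theory Defs
  imports "HOL-Analysis.Analysis"
begin

text \<open>
  A position \<open>(x, y\<^sub>1, y\<^sub>2)\<close> consists of cash and the holdings in two assets; a trade
  \<open>(l\<^sub>1, l\<^sub>2, m\<^sub>1, m\<^sub>2)\<close> buys \<open>l\<^sub>i\<close> and sells \<open>m\<^sub>i\<close> units of asset \<open>i\<close>. Prices are given in the
  order bid 1, bid 2, ask 1, ask 2, written \<open>b1 b2 a1 a2\<close>.
\<close>

definition positions :: "(real \<times> real \<times> real) set" where
  "positions = {(x, y1, y2). 0 \<le> x \<and> 0 \<le> y1 \<and> 0 \<le> y2}"

definition price_domain :: "(real \<times> real \<times> real \<times> real) set" where
  "price_domain = {(b1, b2, a1, a2). 0 < b1 \<and> b1 \<le> a1 \<and> 0 < b2 \<and> b2 \<le> a2}"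

text \<open>
  The value \<open>- \<infinity>\<close> is allowed and both notions below are read in the order and arithmetic of the
  extended reals: the inequalities are strict everywhere on the orthant, not only where the
  function is finite. The values of \<open>g\<close> outside the orthant are unconstrained and never matter.
\<close>

definition strictly_concave_on :: "'a::real_vector set \<Rightarrow> ('a \<Rightarrow> ereal) \<Rightarrow> bool" where
  "strictly_concave_on S f \<longleftrightarrow> convex S \<and>
     (\<forall>p\<in>S. \<forall>q\<in>S. p \<noteq> q \<longrightarrow> (\<forall>t. 0 < t \<and> t < 1 \<longrightarrow>
        ereal (1 - t) * f p + ereal t * f q < f ((1 - t) *\<^sub>R p + t *\<^sub>R q)))"

definition strictly_increasing_each :: "(real \<times> real \<times> real \<Rightarrow> ereal) \<Rightarrow> bool" where
  "strictly_increasing_each g \<longleftrightarrow>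
     (\<forall>y1\<ge>0. \<forall>y2\<ge>0. strict_mono_on {0..} (\<lambda>x. g (x, y1, y2))) \<and>
     (\<forall>x\<ge>0. \<forall>y2\<ge>0. strict_mono_on {0..} (\<lambda>y1. g (x, y1, y2))) \<and>
     (\<forall>x\<ge>0. \<forall>y1\<ge>0. strict_mono_on {0..} (\<lambda>y2. g (x, y1, y2)))"

definition admissible ::
  "real \<Rightarrow> real \<Rightarrow> real \<Rightarrow> real \<Rightarrow> real \<Rightarrow> real \<Rightarrow> real \<Rightarrow> (real \<times> real \<times> real \<times> real) set" where
  "admissible x y1 y2 b1 b2 a1 a2 =
     {(l1, l2, m1, m2). 0 \<le> l1 \<and> 0 \<le> l2 \<and> 0 \<le> m1 \<and> 0 \<le> m2 \<and>
        0 \<le> x + b1 * m1 + b2 * m2 - a1 * l1 - a2 * l2 \<and>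
        0 \<le> y1 - m1 + l1 \<and> 0 \<le> y2 - m2 + l2 \<and> m1 \<le> y1 \<and> m2 \<le> y2}"

definition trade_value ::
  "(real \<times> real \<times> real \<Rightarrow> ereal) \<Rightarrow> real \<Rightarrow> real \<Rightarrow> real \<Rightarrow> real \<Rightarrow> real \<Rightarrow> real \<Rightarrow> real \<Rightarrow>
     real \<Rightarrow> real \<Rightarrow> real \<Rightarrow> real \<Rightarrow> ereal" where
  "trade_value g x y1 y2 b1 b2 a1 a2 l1 l2 m1 m2 =
     g (x + b1 * m1 + b2 * m2 - a1 * l1 - a2 * l2, y1 - m1 + l1, y2 - m2 + l2)"

definition optimal_value ::
  "(real \<times> real \<times> real \<Rightarrow> ereal) \<Rightarrow> real \<Rightarrow> real \<Rightarrow> real \<Rightarrow> real \<Rightarrow> real \<Rightarrow> real \<Rightarrow> real \<Rightarrow> ereal" where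
  "optimal_value g x y1 y2 b1 b2 a1 a2 =
     (SUP (l1, l2, m1, m2) \<in> admissible x y1 y2 b1 b2 a1 a2.
        trade_value g x y1 y2 b1 b2 a1 a2 l1 l2 m1 m2)"

definition admissible_dir ::
  "int \<Rightarrow> int \<Rightarrow> real \<Rightarrow> real \<Rightarrow> real \<Rightarrow> real \<Rightarrow> real \<Rightarrow> real \<Rightarrow> real \<Rightarrow>
     (real \<times> real \<times> real \<times> real) set" where
  "admissible_dir i1 i2 x y1 y2 b1 b2 a1 a2 =
     {(l1, l2, m1, m2). (l1, l2, m1, m2) \<in> admissible x y1 y2 b1 b2 a1 a2 \<and>
        of_int i1 = sgn (l1 - m1) \<and> of_int i2 = sgn (l2 - m2) \<and> l1 * m1 + l2 * m2 = 0}"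

definition trading_set ::
  "(real \<times> real \<times> real \<Rightarrow> ereal) \<Rightarrow> int \<Rightarrow> int \<Rightarrow> real \<Rightarrow> real \<Rightarrow> real \<Rightarrow> real \<Rightarrow>
     (real \<times> real \<times> real) set" where
  "trading_set g i1 i2 b1 b2 a1 a2 =
     {(x, y1, y2). (x, y1, y2) \<in> positions \<and>
        (\<exists>(l1, l2, m1, m2) \<in> admissible_dir i1 i2 x y1 y2 b1 b2 a1 a2.
           optimal_value g x y1 y2 b1 b2 a1 a2 =
             trade_value g x y1 y2 b1 b2 a1 a2 l1 l2 m1 m2)}"

end

theory Submission imports Defs begin

text \<open>
  A trade that only buys asset 2 never uses the bid price of that asset: its admissibility and its
  outcome are the same for the bids \<open>b2\<close> and \<open>a2\<close>. A trade in direction \<open>(i, 1)\<close> is of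
  this kind, because \<open>l1 * m1 + l2 * m2 = 0\<close> with nonnegative entries and \<open>l2 > m2\<close> forces
  \<open>m2 = 0\<close>. So the corollary amounts to saying that such a trade is optimal for the one bid
  exactly when it is optimal for the other.

  A higher bid can only help (\<open>optimal_value_mono_bid\<close>), hence optimality at the bid \<open>a2\<close>
  gives optimality at \<open>b2\<close>. Conversely, let a trade that buys a positive amount of asset 2 be
  optimal at the bid \<open>b2\<close>, and suppose that some trade does better at the bid \<open>a2\<close>. Moving a
  little way from the first trade towards the second still means a net purchase of asset 2, and
  by concavity it already improves the value. When bid and ask of asset 2 coincide, only
  the net amount traded in it matters, so the mixed trade can be replaced by a pure purchase. The
  latter is available at the bid \<open>b2\<close> too, with the same outcome, which contradicts optimality
  there (\<open>purchase_optimal_without_spread\<close>).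
\<close>

text \<open>
  Where \<open>f p\<close> is finite this is the usual averaging argument. Where \<open>f p = - \<infinity>\<close> it rests on the
  inequality in the definition being strict also at infinite values, which keeps \<open>f\<close> above \<open>- \<infinity>\<close> in the
  interior of every segment.
\<close>

lemma strictly_concave_on_improves_on_segment:
  fixes f :: "'a::real_vector \<Rightarrow> ereal"
  assumes "strictly_concave_on S f" "p \<in> S" "q \<in> S"
    and less: "f p < f q" and fin: "f q \<noteq> \<infinity>" and t: "0 < t" "t < 1"
  shows "f p < f ((1 - t) *\<^sub>R p + t *\<^sub>R q)"
proof -
  have *: "ereal (1 - t) * f p + ereal t * f q < f ((1 - t) *\<^sub>R p + t *\<^sub>R q)"
    using assms(1,2,3) t less unfolding strictly_concave_on_def by (metis order.irrefl)
  show ?thesis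
  proof (cases "f p")
    case MInf
    have "f ((1 - t) *\<^sub>R p + t *\<^sub>R q) \<noteq> - \<infinity>"
      using * by (metis ereal_less_eq(2) leD)
    then show ?thesis unfolding MInf by simp
  next
    case (real r)
    then obtain s where s: "f q = ereal s" "r < s"
      using less fin by (cases "f q") auto
    have "r < (1 - t) * r + t * s"
      using mult_strict_left_mono[OF s(2) t(1)] by (simp add: left_diff_distrib)
    then have "f p < ereal (1 - t) * f p + ereal t * f q"
      using real s(1) by simp
    then show ?thesis using * by (rule less_trans)
  next
    case PInf
    then show ?thesis using less by simp
  qed
qed

lemma trade_value_purchase_eq:
  "trade_value g x y1 y2 b1 b a1 a2 l1 l2 m1 0 = trade_value g x y1 y2 b1 b' a1 a2 l1 l2 m1 0"
  by (simp add: trade_value_def)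

lemma admissible_dir_buy_second:
  assumes "(l1, l2, m1, m2) \<in> admissible_dir i 1 x y1 y2 b1 b2 a1 a2"
  shows "m2 = 0" "0 < l2"
proof -
  have nonneg: "0 \<le> l1" "0 \<le> l2" "0 \<le> m1" "0 \<le> m2"
    and "sgn (l2 - m2) = 1" and compl: "l1 * m1 + l2 * m2 = 0"
    using assms by (auto simp: admissible_dir_def admissible_def)
  then have "m2 < l2" by (simp add: sgn_1_pos)
  then show "0 < l2" using nonneg by simp
  have "0 \<le> l1 * m1" "0 \<le> l2 * m2" using nonneg by simp_all
  then have "l2 * m2 = 0" using compl by linarith
  then show "m2 = 0" using \<open>0 < l2\<close> by simp
qed

lemma admissible_dir_purchase_iff:
  "(l1, l2, m1, 0) \<in> admissible_dir i1 i2 x y1 y2 b1 b a1 a2 \<longleftrightarrow>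
   (l1, l2, m1, 0) \<in> admissible_dir i1 i2 x y1 y2 b1 b' a1 a2"
  by (simp add: admissible_dir_def admissible_def)

lemma trade_value_le_optimal_value:
  assumes "(l1, l2, m1, m2) \<in> admissible x y1 y2 b1 b2 a1 a2"
  shows "trade_value g x y1 y2 b1 b2 a1 a2 l1 l2 m1 m2 \<le> optimal_value g x y1 y2 b1 b2 a1 a2"
  unfolding optimal_value_def using assms by (rule SUP_upper2) simp

lemma optimal_value_leI:
  assumes "\<And>l1 l2 m1 m2. (l1, l2, m1, m2) \<in> admissible x y1 y2 b1 b2 a1 a2 \<Longrightarrow>
             trade_value g x y1 y2 b1 b2 a1 a2 l1 l2 m1 m2 \<le> u"
  shows "optimal_value g x y1 y2 b1 b2 a1 a2 \<le> u"
  unfolding optimal_value_def using assms by (auto intro!: SUP_least)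

text \<open>
  At a higher bid for asset 2 every trade stays admissible and leaves at least as much cash.
\<close>

lemma optimal_value_mono_bid:
  assumes incr: "strictly_increasing_each g" and "b \<le> b'"
  shows "optimal_value g x y1 y2 b1 b a1 a2 \<le> optimal_value g x y1 y2 b1 b' a1 a2"
proof (rule optimal_value_leI)
  fix l1 l2 m1 m2
  assume adm: "(l1, l2, m1, m2) \<in> admissible x y1 y2 b1 b a1 a2"
  let ?c = "\<lambda>b. x + b1 * m1 + b * m2 - a1 * l1 - a2 * l2"
  have "b * m2 \<le> b' * m2"
    using adm \<open>b \<le> b'\<close> by (auto simp: admissible_def intro: mult_right_mono)
  then have cash: "?c b \<le> ?c b'" by simp
  have nonneg: "0 \<le> ?c b" "0 \<le> y1 - m1 + l1" "0 \<le> y2 - m2 + l2"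
    using adm by (auto simp: admissible_def)
  have "strict_mono_on {0..} (\<lambda>z. g (z, y1 - m1 + l1, y2 - m2 + l2))"
    using incr nonneg(2,3) unfolding strictly_increasing_each_def by blast
  then have "trade_value g x y1 y2 b1 b a1 a2 l1 l2 m1 m2
      \<le> trade_value g x y1 y2 b1 b' a1 a2 l1 l2 m1 m2"
    unfolding trade_value_def
    using strict_mono_on_leD[of "{0..}" "\<lambda>z. g (z, y1 - m1 + l1, y2 - m2 + l2)" "?c b" "?c b'"]
      cash nonneg(1) by simp
  also have "\<dots> \<le> optimal_value g x y1 y2 b1 b' a1 a2"
    using adm cash by (intro trade_value_le_optimal_value) (auto simp: admissible_def)
  finally show "trade_value g x y1 y2 b1 b a1 a2 l1 l2 m1 m2
      \<le> optimal_value g x y1 y2 b1 b' a1 a2" .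
qed

text \<open>
  Closing the spread of asset 2 lets an investor sell this asset on better terms, but an investor
  who is about to buy it gains nothing: a profitable sale would show up already as a
  profitable reduction of the purchase.
\<close>

lemma purchase_optimal_without_spread:
  assumes fin: "\<And>p. p \<in> positions \<Longrightarrow> g p \<noteq> \<infinity>"
    and conc: "strictly_concave_on positions g"
    and adm: "(l1, l2, m1, 0) \<in> admissible x y1 y2 b1 b2 a1 a2" and "0 < l2"
    and opt: "optimal_value g x y1 y2 b1 b2 a1 a2
                = trade_value g x y1 y2 b1 b2 a1 a2 l1 l2 m1 0"
  shows "optimal_value g x y1 y2 b1 a2 a1 a2 \<le> trade_value g x y1 y2 b1 a2 a1 a2 l1 l2 m1 0"
proof (rule optimal_value_leI, rule ccontr)
  fix k1 k2 n1 n2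
  assume adm': "(k1, k2, n1, n2) \<in> admissible x y1 y2 b1 a2 a1 a2"
    and "\<not> trade_value g x y1 y2 b1 a2 a1 a2 k1 k2 n1 n2
           \<le> trade_value g x y1 y2 b1 a2 a1 a2 l1 l2 m1 0"
  define p where "p = (x + b1 * m1 - a1 * l1 - a2 * l2, y1 - m1 + l1, y2 + l2)"
  define q where "q = (x + b1 * n1 + a2 * n2 - a1 * k1 - a2 * k2, y1 - n1 + k1, y2 - n2 + k2)"
  have less: "g p < g q"
    using \<open>\<not> _\<close> by (simp add: p_def q_def trade_value_def)
  have pq: "p \<in> positions" "q \<in> positions"
    using adm adm' by (auto simp: p_def q_def positions_def admissible_def)
  have nonneg: "0 \<le> k2" "0 \<le> n2" using adm' by (auto simp: admissible_def)
  \<comment> \<open>The weight is small enough for the mixture of both trades to buy asset 2 on balance.\<close>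
  define t where "t = l2 / (l2 + n2 + 1)"
  have t: "0 < t" "t < 1" using \<open>0 < l2\<close> nonneg by (simp_all add: t_def)
  define j1 where "j1 = (1 - t) * l1 + t * k1"
  define j2 where "j2 = (1 - t) * l2 + t * (k2 - n2)"
  define s1 where "s1 = (1 - t) * m1 + t * n1"
  have "t * (l2 + n2 + 1) = l2" using \<open>0 < l2\<close> nonneg by (simp add: t_def)
  then have "j2 = t + t * k2" by (simp add: j2_def algebra_simps)
  then have j2: "0 \<le> j2" using t nonneg by simp
  have mix: "(1 - t) *\<^sub>R p + t *\<^sub>R q
      = (x + b1 * s1 - a1 * j1 - a2 * j2, y1 - s1 + j1, y2 + j2)"
    by (simp add: p_def q_def j1_def j2_def s1_def algebra_simps)
  have "convex positions" using conc by (simp add: strictly_concave_on_def)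
  then have "(1 - t) *\<^sub>R p + t *\<^sub>R q \<in> positions"
    using pq t by (auto intro: convexD)
  then have mix_pos: "0 \<le> x + b1 * s1 - a1 * j1 - a2 * j2" "0 \<le> y1 - s1 + j1"
    unfolding mix by (auto simp: positions_def)
  have "0 \<le> j1" "0 \<le> s1"
    using adm adm' t by (auto simp: j1_def s1_def admissible_def)
  moreover have "s1 \<le> y1"
    using adm adm' t unfolding s1_def
    by (intro convex_bound_le) (auto simp: admissible_def)
  ultimately have "(j1, j2, s1, 0) \<in> admissible x y1 y2 b1 b2 a1 a2"
    using mix_pos j2 adm by (auto simp: admissible_def)
  from trade_value_le_optimal_value[OF this, of g]
  have "g ((1 - t) *\<^sub>R p + t *\<^sub>R q) \<le> g p"
    unfolding opt mix by (simp add: trade_value_def p_def)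
  moreover have "g p < g ((1 - t) *\<^sub>R p + t *\<^sub>R q)"
    using strictly_concave_on_improves_on_segment[OF conc pq less fin[OF pq(2)] t] .
  ultimately show False by (rule leD[THEN notE])
qed

theorem corollary6p9:
  fixes g :: "real \<times> real \<times> real \<Rightarrow> ereal"
    and b1 b2 a1 a2 :: real
    and i :: int
  assumes "\<And>p. p \<in> positions \<Longrightarrow> g p \<noteq> \<infinity>"
    and "strictly_concave_on positions g"
    and "strictly_increasing_each g"
    and "(b1, b2, a1, a2) \<in> price_domain"
    and "i \<in> {-1, 0, 1}"
  shows "trading_set g i 1 b1 b2 a1 a2 = trading_set g i 1 b1 a2 a1 a2"
proof -
  have "b2 \<le> a2" using assms(4) by (simp add: price_domain_def)
  have same_optimal_trades:
    "(l1, l2, m1, m2) \<in> admissible_dir i 1 x y1 y2 b1 b2 a1 a2 \<and>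
       optimal_value g x y1 y2 b1 b2 a1 a2 = trade_value g x y1 y2 b1 b2 a1 a2 l1 l2 m1 m2 \<longleftrightarrow>
     (l1, l2, m1, m2) \<in> admissible_dir i 1 x y1 y2 b1 a2 a1 a2 \<and>
       optimal_value g x y1 y2 b1 a2 a1 a2 = trade_value g x y1 y2 b1 a2 a1 a2 l1 l2 m1 m2"
    for x y1 y2 l1 l2 m1 m2
  proof -
    let ?D = "\<lambda>b. (l1, l2, m1, m2) \<in> admissible_dir i 1 x y1 y2 b1 b a1 a2"
    let ?\<Phi> = "\<lambda>b. optimal_value g x y1 y2 b1 b a1 a2"
    let ?\<phi> = "\<lambda>b. trade_value g x y1 y2 b1 b a1 a2 l1 l2 m1 m2"
    show ?thesis
    proof (cases "?D b2 \<or> ?D a2")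
      case False
      then show ?thesis by simp
    next
      case True
      then have m2: "m2 = 0" and "0 < l2"
        using admissible_dir_buy_second[of l1 l2 m1 m2 i x y1 y2 b1] by auto
      have "?D b2" "?D a2"
        using True admissible_dir_purchase_iff[of l1 l2 m1 i 1 x y1 y2 b1 b2 a1 a2 a2]
        unfolding m2 by auto
      have adm: "(l1, l2, m1, 0) \<in> admissible x y1 y2 b1 b2 a1 a2"
        "(l1, l2, m1, 0) \<in> admissible x y1 y2 b1 a2 a1 a2"
        using \<open>?D b2\<close> \<open>?D a2\<close> m2 by (auto simp: admissible_dir_def)
      have \<phi>: "?\<phi> b2 = ?\<phi> a2" unfolding m2 by (rule trade_value_purchase_eq)
      have attained: "?\<phi> b2 \<le> ?\<Phi> b2" "?\<phi> a2 \<le> ?\<Phi> a2"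
        unfolding m2 using adm by (auto intro: trade_value_le_optimal_value)
      have "?\<Phi> b2 = ?\<phi> b2" if "?\<Phi> a2 = ?\<phi> a2"
        using that \<phi> attained(1) optimal_value_mono_bid[OF assms(3) \<open>b2 \<le> a2\<close>]
        by (metis order.antisym)
      moreover have "?\<Phi> a2 = ?\<phi> a2" if "?\<Phi> b2 = ?\<phi> b2"
        using that attained(2)
          purchase_optimal_without_spread[OF assms(1,2) adm(1) \<open>0 < l2\<close>]
        unfolding m2 by (auto intro: order.antisym)
      ultimately show ?thesis using \<open>?D b2\<close> \<open>?D a2\<close> by blast
    qed
  qed
  show ?thesis
    unfolding trading_set_def Bex_def by (simp add: same_optimal_trades)
qed

end
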